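(* Let $\Lambda$ be a numerical semigroup. (1) If $\Lambda$ is symmetric then it is acute. (2) If $\Lambda$ is pseudo-symmetric then it is acute. (3) If $\Lambda$ is Arf then it is acute. (4) If $\Lambda$ is generated by an interval then it is acute.
   Context: $\mathbb{N}_0$ is the set of non-negative integers. A numerical semigroup is a subset $\Lambda\subseteq\mathbb{N}_0$ containing $0$, closed under addition, with finite complement in $\mathbb{N}_0$. Elements of $\Lambda$ are non-gaps and elements of $\mathbb{N}_0\setminus\Lambda$ are gaps. The genus is $g=\#(\mathbb{N}_0\setminus\Lambda)$; the conductor is the unique $c\in\Lambda$ with $c-1\notin\Lambda$ and $c+\mathbb{N}_0\subseteq\Lambda$. The enumeration of $\Lambda$ is the unique increasing bijection $\lambda:\mathbb{N}_0\to\Lambda$, written $\lambda_i=\lambda(i)$. $\Lambda$ is symmetric if $c=2g$; pseudo-symmetric if $c=2g-1$; Arf if $\lambda_i+\lambda_j-\lambda_k\in\Lambda$ for all $i\geq j\geq k$ in $\mathbb{N}_0$; generated by an interval if there are $i\leq j$ in $\mathbb{N}_0$ with $\Lambda=\{n_i i+n_{i+1}(i+1)+\dots+n_j j\mid n_i,\dots,n_j\in\mathbb{N}_0\}$. $\Lambda$ is ordinary if $\Lambda=\{0\}\cup\{i\in\mathbb{N}_0\mid i\geq c\}$ for some non-negative integer $c$. For $\Lambda\neq\mathbb{N}_0$, the dominant is $d=\lambda_{\lambda^{-1}(c)-1}$ (the largest non-gap smaller than the conductor). Let $g(i)$ be the number of gaps smaller than $\lambda_i$. The subconductor is $c'=\lambda_i$,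 where $i$ is the smallest integer with $g(i)=g(\lambda^{-1}(d))$. If $\Lambda$ is non-ordinary (in which case $c'>0$), the subdominant is $d'=\lambda_{i-1}$, where $c'=\lambda_i$. $\Lambda$ is acute if it is ordinary, or if it is non-ordinary and $c-d\leq c'-d'$. *)

theory Defs
  imports Main "HOL-Library.Infinite_Set"
begin

definition numerical_semigroup :: "nat set \<Rightarrow> bool" where
  "numerical_semigroup S \<longleftrightarrow>
     0 \<in> S \<and> (\<forall>a\<in>S. \<forall>b\<in>S. a + b \<in> S) \<and> finite (- S)"

definition genus :: "nat set \<Rightarrow> nat" where
  "genus S = card (- S)"

text \<open>The condition that c - 1 is not in S is read in the integers, so that the conductor of
  the semigroup of all naturals is 0; truncated subtraction would leave it without a conductor.\<close>

definition is_conductor :: "nat set \<Rightarrow> nat \<Rightarrow> bool" where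
  "is_conductor S c \<longleftrightarrow> c \<in> S \<and> int c - 1 \<notin> int ` S \<and> (\<forall>n. c + n \<in> S)"

definition conductor :: "nat set \<Rightarrow> nat" where
  "conductor S = (THE c. is_conductor S c)"

lemma ex1_is_conductor:
  assumes "numerical_semigroup S"
  shows "\<exists>!c. is_conductor S c"
proof -
  let ?P = "\<lambda>c. \<forall>n. c + n \<in> S"
  have "finite (- S)" using assms by (simp add: numerical_semigroup_def)
  then obtain m where m: "\<forall>x\<in>- S. x < m"
    using finite_nat_set_iff_bounded by blast
  have "?P m"
  proof
    fix n
    show "m + n \<in> S"
    proof (rule ccontr)
      assume "m + n \<notin> S"
      then have "m + n < m" using m by blast
      then show False by simp
    qed
  qed
  define c where "c = (LEAST c. ?P c)"
  have c: "?P c" unfolding c_def using \<open>?P m\<close> by (rule LeastI)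
  have "int c - 1 \<notin> int ` S"
  proof
    assume "int c - 1 \<in> int ` S"
    then obtain b where b: "b \<in> S" "c = Suc b" by force
    have "?P b"
    proof
      fix n show "b + n \<in> S"
        using b c[rule_format, of "n - 1"] by (cases n) auto
    qed
    then have "c \<le> b" unfolding c_def by (rule Least_le)
    then show False using b by simp
  qed
  moreover have "c \<in> S" using c[rule_format, of 0] by simp
  ultimately have "is_conductor S c" using c by (simp add: is_conductor_def)
  moreover have "x \<ge> y" if x: "is_conductor S x" and y: "is_conductor S y" for x y
  proof (rule ccontr)
    assume "\<not> x \<ge> y"
    then have l: "x + (y - 1 - x) = y - 1" "int y - 1 = int (y - 1)" by linarith+
    have "x + (y - 1 - x) \<in> S" using x unfolding is_conductor_def by blast
    then have "y - 1 \<in> S" by (simp only: l(1))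
    then have "int y - 1 \<in> int ` S" unfolding l(2) by (rule imageI)
    then show False using y unfolding is_conductor_def by blast
  qed
  ultimately show ?thesis by (blast intro: order_antisym)
qed

text \<open>The enumeration of S is \<^term>\<open>enumerate S\<close>.\<close>

definition index :: "nat set \<Rightarrow> nat \<Rightarrow> nat" where
  "index S = inv (enumerate S)"

definition symmetric_semigroup :: "nat set \<Rightarrow> bool" where
  "symmetric_semigroup S \<longleftrightarrow> conductor S = 2 * genus S"

definition pseudo_symmetric_semigroup :: "nat set \<Rightarrow> bool" where
  "pseudo_symmetric_semigroup S \<longleftrightarrow> int (conductor S) = 2 * int (genus S) - 1"

text \<open>In the next definition the subtraction never truncates, because the enumeration is
  increasing and \<open>k \<le> j\<close>.\<close>

definition arf_semigroup :: "nat set \<Rightarrow> bool" where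
  "arf_semigroup S \<longleftrightarrow>
     (\<forall>i j k. k \<le> j \<and> j \<le> i \<longrightarrow> enumerate S i + enumerate S j - enumerate S k \<in> S)"

definition generated_by_interval :: "nat set \<Rightarrow> bool" where
  "generated_by_interval S \<longleftrightarrow>
     (\<exists>i j. i \<le> j \<and> S = {(\<Sum>k=i..j. n k * k) | n :: nat \<Rightarrow> nat. True})"

definition ordinary :: "nat set \<Rightarrow> bool" where
  "ordinary S \<longleftrightarrow> (\<exists>c. S = {0} \<union> {i. i \<ge> c})"

text \<open>The dominant is meaningful only for \<open>S \<noteq> UNIV\<close>, the subdominant only for
  non-ordinary S; elsewhere the index subtraction truncates and the values are not used.\<close>

definition dominant :: "nat set \<Rightarrow> nat" where
  "dominant S = enumerate S (index S (conductor S) - 1)"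

definition gaps_before :: "nat set \<Rightarrow> nat \<Rightarrow> nat" where
  "gaps_before S i = card {x. x \<notin> S \<and> x < enumerate S i}"

definition subconductor :: "nat set \<Rightarrow> nat" where
  "subconductor S =
     enumerate S (LEAST i. gaps_before S i = gaps_before S (index S (dominant S)))"

definition subdominant :: "nat set \<Rightarrow> nat" where
  "subdominant S = enumerate S (index S (subconductor S) - 1)"

definition acute :: "nat set \<Rightarrow> bool" where
  "acute S \<longleftrightarrow> ordinary S \<or>
     (\<not> ordinary S \<and>
      int (conductor S) - int (dominant S) \<le> int (subconductor S) - int (subdominant S))"

end

theory Submission
  imports Defs
begin

text \<open>Non-acuteness would mean c - d > c' - d' \<ge> 2. For an Arf semigroup, d + c' - d' is a non-gap
  above d, hence at least c. If c \<ge> 2g - 1, the reflection x \<mapsto> c - 1 - x sends non-gaps below c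
  to gaps and misses at most one gap; it swaps 1 and c - 2, which differ because c = 3 would make the
  semigroup ordinary, so c - 2 is a non-gap and c - d = 2.
  A semigroup generated by {i..j} is the union of the blocks {k i..k j}, and the distance from
  block k to block k + 1 does not increase with k.\<close>

section \<open>Numerical semigroups and their enumeration\<close>

lemma infinite_numerical_semigroup:
  assumes "numerical_semigroup S"
  shows "infinite S"
  using assms Compl_eq_Diff_UNIV finite_compl by (auto simp: numerical_semigroup_def)

lemma numerical_semigroup_UNIV:
  assumes "numerical_semigroup S" "1 \<in> S"
  shows "S = UNIV"
proof -
  have "n \<in> S" for n
  proof (induction n)
    case 0
    show ?case using assms by (simp add: numerical_semigroup_def)
  next
    case (Suc n)
    then have "n + 1 \<in> S" using assms unfolding numerical_semigroup_def by blast
    then show ?case by simp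
  qed
  then show ?thesis by blast
qed

lemma index_enumerate:
  assumes "infinite (S :: nat set)"
  shows "index S (enumerate S n) = n"
  unfolding index_def
  using strict_mono_imp_inj_on[OF strict_mono_enumerate[OF assms]] by (rule inv_f_f)

text \<open>Applied to the conductor and to the subconductor, this makes the dominant and the
  subdominant the largest non-gaps below them. As \<open>0\<close> is in \<open>S\<close> and
  \<open>s\<close> is positive, \<open>index S s\<close> is positive and the subtraction does not
  truncate.\<close>

lemma enumerate_predecessor:
  assumes "infinite (S :: nat set)" "s \<in> S" "0 \<in> S" "0 < s"
  shows "enumerate S (index S s - 1) \<in> S"
    and "enumerate S (index S s - 1) < s"
    and "\<And>x. x \<in> S \<Longrightarrow> x < s \<Longrightarrow> x \<le> enumerate S (index S s - 1)"
proof -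
  obtain n where n: "enumerate S n = s"
    using enumerate_Ex[OF assms(1,2)] by blast
  then have i: "index S s = n"
    using index_enumerate[OF assms(1)] by blast
  have "enumerate S 0 = 0"
    unfolding enumerate_0 using assms(3) by simp
  then have "n \<noteq> 0"
    using n assms(4) by (metis less_irrefl)
  show "enumerate S (index S s - 1) \<in> S"
    using assms(1) by (rule enumerate_in_set)
  show "enumerate S (index S s - 1) < s"
    unfolding i using enumerate_mono[of "n - 1" n S] assms(1) n \<open>n \<noteq> 0\<close> by simp
  show "x \<le> enumerate S (index S s - 1)" if x: "x \<in> S" "x < s" for x
  proof -
    obtain m where m: "enumerate S m = x"
      using enumerate_Ex[OF assms(1) x(1)] by blast
    have "m < n"
      using m n x(2) assms(1) by (metis enumerate_mono_iff)
    then have "m \<le> n - 1" by simp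
    then show ?thesis
      unfolding i m[symmetric] using assms(1) by simp
  qed
qed

lemma mult_interval_sums:
  fixes i j :: nat
  assumes "i \<le> j" "{i..j} \<subseteq> S" "0 \<in> S" "\<And>x y. x \<in> S \<Longrightarrow> y \<in> S \<Longrightarrow> x + y \<in> S"
  shows "k * i \<le> x \<Longrightarrow> x \<le> k * j \<Longrightarrow> x \<in> S"
proof (induction k arbitrary: x)
  case 0
  then show ?case using assms by simp
next
  case (Suc k)
  \<comment> \<open>One generator \<open>y\<close> is split off so that the rest is a sum of
    \<open>k\<close> generators: the smallest one if the rest still fits under \<open>k * j\<close>,
    otherwise the one that leaves exactly \<open>k * j\<close>.\<close>
  define y where "y = (if x \<le> i + k * j then i else x - k * j)"
  have ki: "k * i \<le> k * j" using assms(1) by simp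
  have y: "y \<in> {i..j}" "y \<le> x" "k * i \<le> x - y" "x - y \<le> k * j"
    using Suc.prems assms(1) ki by (auto simp: y_def)
  then have "y + (x - y) \<in> S"
    using Suc.IH assms by blast
  then show ?case using y(2) by simp
qed

text \<open>\<open>k\<close> counts the generators used, with multiplicity: it is the sum of the
  coefficients.\<close>

lemma generated_by_interval_blocks:
  assumes "numerical_semigroup S" "generated_by_interval S"
  obtains i j where "i \<le> j" "\<And>x. x \<in> S \<longleftrightarrow> (\<exists>k. k * i \<le> x \<and> x \<le> k * j)"
proof -
  obtain i j where ij: "i \<le> j" and S: "S = {(\<Sum>k=i..j. n k * k) | n :: nat \<Rightarrow> nat. True}"
    using assms(2) unfolding generated_by_interval_def by blast
  have "x \<in> S \<longleftrightarrow> (\<exists>k. k * i \<le> x \<and> x \<le> k * j)" for x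
  proof
    assume "x \<in> S"
    then obtain n where n: "x = (\<Sum>k=i..j. n k * k)" unfolding S by blast
    have "(\<Sum>k=i..j. n k) * i \<le> x" "x \<le> (\<Sum>k=i..j. n k) * j"
      unfolding n sum_distrib_right by (auto intro!: sum_mono)
    then show "\<exists>k. k * i \<le> x \<and> x \<le> k * j" by blast
  next
    have "{i..j} \<subseteq> S"
    proof
      fix y assume y: "y \<in> {i..j}"
      then have "y = (\<Sum>k=i..j. of_bool (k = y) * k)"
        by (simp add: of_bool_def if_distrib[of "\<lambda>b. b * _"] cong: if_cong)
      then show "y \<in> S" unfolding S by (intro CollectI exI[of _ "\<lambda>k. of_bool (k = y)"]) simp
    qed
    moreover assume "\<exists>k. k * i \<le> x \<and> x \<le> k * j"
    ultimately show "x \<in> S"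
      using assms(1) ij mult_interval_sums[of i j S] unfolding numerical_semigroup_def by blast
  qed
  with ij show ?thesis by (rule that)
qed

section \<open>Conductor, dominant, subconductor and subdominant\<close>

locale non_ordinary_semigroup =
  fixes S :: "nat set"
  assumes semigroup: "numerical_semigroup S"
    and non_ordinary: "\<not> ordinary S"
begin

abbreviation c where "c \<equiv> conductor S"
abbreviation d where "d \<equiv> dominant S"
abbreviation c' where "c' \<equiv> subconductor S"
abbreviation d' where "d' \<equiv> subdominant S"

lemma zero_mem: "0 \<in> S"
  and add_mem: "x \<in> S \<Longrightarrow> y \<in> S \<Longrightarrow> x + y \<in> S"
  and infinite: "infinite S"
  using semigroup infinite_numerical_semigroup[OF semigroup] by (auto simp: numerical_semigroup_def)

lemma one_not_mem: "1 \<notin> S"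
proof
  assume "1 \<in> S"
  then have "S = {0} \<union> {i. i \<ge> 0}"
    using numerical_semigroup_UNIV[OF semigroup] by simp
  then show False
    using non_ordinary unfolding ordinary_def by blast
qed

lemma is_conductor: "is_conductor S c"
  unfolding conductor_def using ex1_is_conductor[OF semigroup] by (rule theI')

lemma mem_if_ge_conductor: "c \<le> x \<Longrightarrow> x \<in> S"
  using is_conductor unfolding is_conductor_def by (metis le_add_diff_inverse)

lemma conductor_pos: "0 < c"
  using mem_if_ge_conductor[of 1] one_not_mem by (cases "c = 0") auto

lemma pred_conductor_not_mem: "c - 1 \<notin> S"
proof
  assume "c - 1 \<in> S"
  then have "int (c - 1) \<in> int ` S" by (rule imageI)
  then show False
    using is_conductor conductor_pos by (simp add: is_conductor_def)
qed

lemma dominant_mem: "d \<in> S"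
  and dominant_less: "d < c"
  and le_dominant: "x \<in> S \<Longrightarrow> x < c \<Longrightarrow> x \<le> d"
  using enumerate_predecessor[OF infinite mem_if_ge_conductor[OF order_refl] zero_mem conductor_pos]
  by (simp_all add: dominant_def)

lemma ge_conductor: "x \<in> S \<Longrightarrow> d < x \<Longrightarrow> c \<le> x"
  using le_dominant by (meson not_le)

lemma Suc_dominant_not_mem: "Suc d \<notin> S"
proof
  assume "Suc d \<in> S"
  then have "c = Suc d"
    using ge_conductor dominant_less by (simp add: order_antisym Suc_leI)
  then show False
    using pred_conductor_not_mem dominant_mem by simp
qed

lemma dominant_pos: "0 < d"
proof (rule ccontr)
  assume "\<not> 0 < d"
  then have "S = {0} \<union> {i. i \<ge> c}"
    using zero_mem mem_if_ge_conductor le_dominant by (force simp: not_less)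
  then show False
    using non_ordinary unfolding ordinary_def by blast
qed

text \<open>As many gaps lie below \<open>c'\<close> as below \<open>d\<close>, so \<open>c'\<close>
  starts the run of consecutive non-gaps that contains \<open>d\<close>. The run does not start at
  0, because 1 is a gap.\<close>

lemma subconductor:
  shows subconductor_mem: "c' \<in> S"
    and subconductor_le_dominant: "c' \<le> d"
    and subconductor_pos: "0 < c'"
    and pred_subconductor_not_mem: "c' - 1 \<notin> S"
proof -
  define P where "P i \<longleftrightarrow> gaps_before S i = gaps_before S (index S d)" for i
  define l where "l = (LEAST i. P i)"
  have c'_eq: "c' = enumerate S l"
    by (simp add: subconductor_def l_def P_def)
  have "P l"
    unfolding l_def by (rule LeastI[of P "index S d"]) (simp add: P_def)
  have d_eq: "enumerate S (index S d) = d"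
    using enumerate_Ex[OF infinite dominant_mem] index_enumerate[OF infinite] by metis
  have "l \<le> index S d"
    unfolding l_def by (rule Least_le) (simp add: P_def)
  then have "enumerate S l \<le> enumerate S (index S d)"
    using infinite by simp
  then show le: "c' \<le> d"
    by (simp only: c'_eq d_eq)
  show mem: "c' \<in> S"
    unfolding c'_eq using infinite by (rule enumerate_in_set)
  have card_eq: "card {x. x \<notin> S \<and> x < c'} = card {x. x \<notin> S \<and> x < d}"
    using \<open>P l\<close> by (simp add: P_def gaps_before_def c'_eq d_eq)
  have gaps_eq: "{x. x \<notin> S \<and> x < c'} = {x. x \<notin> S \<and> x < d}"
  proof (rule card_subset_eq)
    show "{x. x \<notin> S \<and> x < c'} \<subseteq> {x. x \<notin> S \<and> x < d}" using le by auto
  qed (use card_eq in simp_all)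
  show pos: "0 < c'"
  proof (rule ccontr)
    assume "\<not> 0 < c'"
    then have "{x. x \<notin> S \<and> x < d} = {}" using gaps_eq by simp
    then have "1 \<in> S"
      using dominant_mem dominant_pos by (cases "d = 1") auto
    then show False using one_not_mem by simp
  qed
  show "c' - 1 \<notin> S"
  proof
    assume pred: "c' - 1 \<in> S"
    then obtain m where m: "enumerate S m = c' - 1"
      using enumerate_Ex[OF infinite] by blast
    \<comment> \<open>If \<open>c' - 1\<close> were a non-gap, the gaps below it would be those
      below \<open>c'\<close>, and its smaller index would contradict the choice of
      \<open>l\<close>.\<close>
    have "x < c' - 1 \<longleftrightarrow> x < c'" if "x \<notin> S" for x
      using pred that by (cases "x = c' - 1") auto
    then have "{x. x \<notin> S \<and> x < c' - 1} = {x. x \<notin> S \<and> x < c'}"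
      by blast
    then have "P m"
      using \<open>P l\<close> by (simp add: P_def gaps_before_def m c'_eq)
    then have "l \<le> m"
      unfolding l_def by (rule Least_le)
    then have "c' \<le> c' - 1"
      unfolding m[symmetric] unfolding c'_eq using infinite by simp
    then show False using pos by simp
  qed
qed

lemma subdominant_mem: "d' \<in> S"
  and subdominant_less: "d' < c'"
  and le_subdominant: "x \<in> S \<Longrightarrow> x < c' \<Longrightarrow> x \<le> d'"
  using enumerate_predecessor[OF infinite subconductor_mem zero_mem subconductor_pos]
  by (simp_all add: subdominant_def)

lemma Suc_subdominant_less: "Suc d' < c'"
proof -
  have "c' \<noteq> Suc d'"
    using pred_subconductor_not_mem subdominant_mem by auto
  then show ?thesis using subdominant_less by simp
qed

lemma Suc_subdominant_not_mem: "Suc d' \<notin> S"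
  using le_subdominant Suc_subdominant_less by (meson not_less_eq_eq order_refl)

text \<open>Clearing the differences keeps the later inequalities in the natural numbers.\<close>

lemma acute_iff: "acute S \<longleftrightarrow> c + d' \<le> c' + d"
  using non_ordinary by (auto simp: acute_def)

section \<open>Acuteness of the four families\<close>

lemma acute_if_arf:
  assumes "arf_semigroup S"
  shows "acute S"
proof -
  obtain i j k where e: "enumerate S i = d" "enumerate S j = c'" "enumerate S k = d'"
    using enumerate_Ex[OF infinite] dominant_mem subconductor_mem subdominant_mem by meson
  \<comment> \<open>The Arf condition orders indices, so \<open>d' < c' \<le> d\<close> is pulled
    back along the increasing enumeration.\<close>
  have "enumerate S k \<le> enumerate S j" "enumerate S j \<le> enumerate S i"
    unfolding e using subdominant_less subconductor_le_dominant by simp_all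
  then have "k \<le> j" "j \<le> i"
    using infinite by simp_all
  then have "d + c' - d' \<in> S"
    using assms e unfolding arf_semigroup_def by metis
  moreover have "d < d + c' - d'" using subdominant_less by simp
  ultimately have "c \<le> d + c' - d'" by (rule ge_conductor)
  then show ?thesis
    unfolding acute_iff using subdominant_less by simp
qed

text \<open>If \<open>c - 2\<close> were a gap, the reflected non-gaps would miss the two gaps 1 and
  \<open>c - 2\<close>. As \<open>c\<close> is the number of non-gaps below it plus the genus,
  \<open>c\<close> would be at most \<open>2 * genus S - 2\<close>.\<close>

lemma conductor_minus_two_mem:
  assumes "2 * genus S \<le> c + 1"
  shows "c - 2 \<in> S"
proof (rule ccontr)
  assume gap: "c - 2 \<notin> S"
  define A where "A = S \<inter> {..<c}"
  have "c \<noteq> 1" using pred_conductor_not_mem zero_mem by auto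
  then have "2 \<le> c" using conductor_pos by simp
  \<comment> \<open>This makes 1 and \<open>c - 2\<close> distinct, so that two gaps are missed. For
    \<open>c = 3\<close> both 1 and 2 would be gaps, leaving no positive dominant.\<close>
  have "c \<noteq> 3"
  proof
    assume "c = 3"
    then have "d \<noteq> 2" "d \<noteq> 1" "d < 3"
      using dominant_mem pred_conductor_not_mem one_not_mem dominant_less by auto
    then show False using dominant_pos by simp
  qed
  have fin: "finite (- S)"
    using semigroup by (simp add: numerical_semigroup_def)
  have sub: "(\<lambda>x. c - 1 - x) ` A \<subseteq> - S - {1, c - 2}"
  proof
    fix y assume "y \<in> (\<lambda>x. c - 1 - x) ` A"
    then obtain x where x: "x \<in> S" "x < c" "y = c - 1 - x"
      by (auto simp: A_def)
    have "y \<notin> S"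
    proof
      assume "y \<in> S"
      with x(1) have "x + y \<in> S" by (rule add_mem)
      then show False using x pred_conductor_not_mem by simp
    qed
    moreover have "y \<noteq> 1"
    proof
      assume "y = 1"
      then have "x = c - 2" using x by simp
      then show False using gap x(1) by simp
    qed
    moreover have "y \<noteq> c - 2"
    proof
      assume "y = c - 2"
      then have "x = 1" using x(2,3) \<open>2 \<le> c\<close> by arith
      then show False using one_not_mem x(1) by simp
    qed
    ultimately show "y \<in> - S - {1, c - 2}" by simp
  qed
  have "card A = card ((\<lambda>x. c - 1 - x) ` A)"
    by (rule card_image[symmetric]) (auto simp: A_def inj_on_def)
  also have "\<dots> \<le> card (- S - {1, c - 2})"
    using fin by (intro card_mono sub) simp
  also have "card {1, c - 2} = 2"
    using \<open>c \<noteq> 3\<close> \<open>2 \<le> c\<close> by simp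
  then have "card (- S - {1, c - 2}) = genus S - 2"
    unfolding genus_def using gap one_not_mem by (subst card_Diff_subset) auto
  finally have "card A \<le> genus S - 2" .
  \<comment> \<open>Ensures that \<open>genus S - 2\<close> does not truncate.\<close>
  moreover have "2 \<le> genus S"
  proof -
    have "card {1, c - 2} \<le> genus S"
      unfolding genus_def using gap one_not_mem fin by (intro card_mono) auto
    then show ?thesis using \<open>card {1, c - 2} = 2\<close> by simp
  qed
  moreover have "c = card A + genus S"
  proof -
    have "A \<union> - S = {..<c}"
      using mem_if_ge_conductor by (auto simp: A_def not_le[symmetric])
    moreover have "card (A \<union> - S) = card A + card (- S)"
      using fin by (intro card_Un_disjoint) (auto simp: A_def)
    ultimately show ?thesis by (simp add: genus_def)
  qed
  ultimately show False using assms by simp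
qed

text \<open>Here \<open>c - d\<close> is at most 2, while \<open>c' - d'\<close> is at least 2
  because a gap lies between \<open>d'\<close> and \<open>c'\<close>.\<close>

lemma acute_if_genus_le:
  assumes "2 * genus S \<le> c + 1"
  shows "acute S"
proof -
  have "c - 2 \<le> d"
    using conductor_minus_two_mem[OF assms] conductor_pos by (intro le_dominant) simp_all
  then show ?thesis
    unfolding acute_iff using Suc_subdominant_less by simp
qed

lemma acute_if_generated_by_interval:
  assumes "generated_by_interval S"
  shows "acute S"
proof -
  obtain i j where ij: "i \<le> j" and S: "\<And>x. x \<in> S \<longleftrightarrow> (\<exists>k. k * i \<le> x \<and> x \<le> k * j)"
    using generated_by_interval_blocks[OF semigroup assms] by metis
  have block_mem: "x \<in> S" if "k * i \<le> x" "x \<le> k * j" for x k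
    unfolding S using that by (intro exI[of _ k] conjI)
  \<comment> \<open>A non-gap followed by a gap must be the right end of any block containing it;
    this applies to \<open>d\<close> and \<open>d'\<close>. Left ends are treated in the same way
    for \<open>c'\<close>.\<close>
  have block_end: "\<exists>k. x = k * j" if x: "x \<in> S" "Suc x \<notin> S" for x
  proof -
    obtain k where k: "k * i \<le> x" "x \<le> k * j" using x(1) S by blast
    then have "\<not> Suc x \<le> k * j"
      using x(2) block_mem[of k "Suc x"] by auto
    then show ?thesis using k(2) by (intro exI[of _ k]) linarith
  qed
  have block_start: "\<exists>k. x = k * i" if x: "x \<in> S" "x - 1 \<notin> S" "0 < x" for x
  proof -
    obtain k where k: "k * i \<le> x" "x \<le> k * j" using x(1) S by blast
    then have "\<not> k * i \<le> x - 1"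
      using x(2) block_mem[of k "x - 1"] by linarith
    then show ?thesis using k(1) by (intro exI[of _ k]) linarith
  qed
  obtain k where k: "d = k * j"
    using block_end dominant_mem Suc_dominant_not_mem by blast
  obtain m where m: "c' = m * i"
    using block_start subconductor_mem pred_subconductor_not_mem subconductor_pos by blast
  obtain l where l: "d' = l * j"
    using block_end subdominant_mem Suc_subdominant_not_mem by blast
  have "0 < j" using dominant_pos k by (cases j) auto
  have next_block: "Suc k * i \<in> S"
    using ij by (intro block_mem[of "Suc k"] mult_le_mono2 order_refl)
  \<comment> \<open>Otherwise block \<open>Suc k\<close> would start at or before \<open>d\<close>
    and reach past it, so it would contain the gap \<open>Suc d\<close>.\<close>
  have "d < Suc k * i"
  proof (rule ccontr)
    assume "\<not> d < Suc k * i"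
    then have "Suc k * i \<le> Suc d" by simp
    moreover have "Suc d \<le> Suc k * j" using k \<open>0 < j\<close> by simp
    ultimately show False
      using block_mem Suc_dominant_not_mem by blast
  qed
  then have c_le: "c \<le> Suc k * i"
    using ge_conductor next_block by blast
  have "m * i < Suc k * i"
    using subconductor_le_dominant \<open>d < Suc k * i\<close> m by linarith
  then have "m \<le> k" by (metis mult_less_cancel2 less_Suc_eq_le)
  have "l < m"
  proof (rule ccontr)
    assume "\<not> l < m"
    then have "m * i \<le> l * j" using ij by (intro mult_le_mono) simp_all
    then show False using subdominant_less m l by simp
  qed
  \<comment> \<open>With \<open>k = m + a\<close> the target inequality reduces to
    \<open>Suc a * i + l * j \<le> (m + a) * j\<close>, which follows from \<open>i \<le> j\<close>
    and \<open>l < m\<close>.\<close>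
  obtain a where a: "k = m + a" using \<open>m \<le> k\<close> by (metis le_add_diff_inverse)
  have "Suc l * j \<le> m * j" using \<open>l < m\<close> by (intro mult_le_mono1) simp
  moreover have "Suc a * i \<le> Suc a * j" using ij by (intro mult_le_mono2)
  ultimately have "Suc k * i + d' \<le> c' + d"
    unfolding k l m a by (simp add: algebra_simps)
  then show ?thesis
    unfolding acute_iff using c_le by linarith
qed

end

theorem proposition5p9:
  fixes \<Lambda> :: "nat set"
  assumes "numerical_semigroup \<Lambda>"
  shows "(symmetric_semigroup \<Lambda> \<longrightarrow> acute \<Lambda>) \<and>
         (pseudo_symmetric_semigroup \<Lambda> \<longrightarrow> acute \<Lambda>) \<and>
         (arf_semigroup \<Lambda> \<longrightarrow> acute \<Lambda>) \<and>
         (generated_by_interval \<Lambda> \<longrightarrow> acute \<Lambda>)"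
proof (cases "ordinary \<Lambda>")
  case True
  then show ?thesis by (simp add: acute_def)
next
  case False
  with assms interpret non_ordinary_semigroup \<Lambda> by unfold_locales
  \<comment> \<open>The symmetric case satisfies the same bound, so one counting argument serves
    both.\<close>
  have "2 * genus \<Lambda> \<le> conductor \<Lambda> + 1" if "pseudo_symmetric_semigroup \<Lambda>"
    using that unfolding pseudo_symmetric_semigroup_def by linarith
  then show ?thesis
    using acute_if_genus_le acute_if_arf acute_if_generated_by_interval
    by (auto simp: symmetric_semigroup_def)
qed

end
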